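(* Let $d\geq 1$ and let $\varphi$ be a partial $d$-edge coloring of $Q_d$. Let $a(d)$ and $b(d)$ be functions satisfying $\frac{109}{1776}d^2 - 2b(d)\left(a(d)-\frac{7d}{8}\right)\geq 0$ and $a(d)\geq b(d)$. (i) If every color appears on at most $d/8$ edges under $\varphi$, every edge of $Q_d$ is parallel to at most $b(d)$ other $\varphi$-colored edges, and every dimensional matching of $Q_d$ contains at most $a(d)$ $\varphi$-colored edges, then $\varphi$ is avoidable. (ii) For every constant $C_1\geq 1$, setting $C_2 = 2C_1(C_1+2)\cdot 34^2$, if every dimensional matching of $Q_d$ contains at most $C_1 d$ $\varphi$-colored edges and every color appears on at most $d/C_2$ edges under $\varphi$, then $\varphi$ is avoidable.
   Context: $Q_d$ is the $d$-dimensional hypercube (vertex set $\{0,1\}^d$, two vertices adjacent iff they differ in exactly one coordinate). For $i=1,\dots,d$, the $i$-th dimensional matching of $Q_d$ is the perfect matching consisting of all edges whose endpoints differ in coordinate $i$. Two edges of $Q_d$ are parallel if they are non-adjacent and lie on a common $4$-cycle. A partial $d$-edge coloring of $Q_d$ assigns colors from $\{1,\dots,d\}$ to some subset of edges (not necessarily properly); it is avoidable if there is a proper $d$-edge coloring $f$ of $Q_d$ with colors $1,\dots,d$ such that $f(e)\neq\varphi(e)$ for every $\varphi$-colored edge $e$. *)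

theory Defs
  imports Complex_Main "HOL-Library.FuncSet"
begin

text \<open>Vertices are 0/1-valued functions on the coordinates \<open>1, \<dots>, d\<close>, extensional so that each
  vertex is represented exactly once; an edge is the two-element set of its endpoints.\<close>

type_synonym vertex = "nat \<Rightarrow> nat"
type_synonym edge = "vertex set"

definition Q_verts :: "nat \<Rightarrow> vertex set" where
  "Q_verts d = ({1..d} \<rightarrow>\<^sub>E {0, 1})"

definition Q_adj :: "nat \<Rightarrow> vertex \<Rightarrow> vertex \<Rightarrow> bool" where
  "Q_adj d u v \<longleftrightarrow> u \<in> Q_verts d \<and> v \<in> Q_verts d \<and> card {i \<in> {1..d}. u i \<noteq> v i} = 1"

definition Q_edges :: "nat \<Rightarrow> edge set" where
  "Q_edges d = {{u, v} | u v. Q_adj d u v}"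

definition dim_matching :: "nat \<Rightarrow> nat \<Rightarrow> edge set" where
  "dim_matching d i = {{u, v} | u v. Q_adj d u v \<and> u i \<noteq> v i}"

definition edges_adjacent :: "edge \<Rightarrow> edge \<Rightarrow> bool" where
  "edges_adjacent e e' \<longleftrightarrow> e \<noteq> e' \<and> e \<inter> e' \<noteq> {}"

definition four_cycles :: "nat \<Rightarrow> edge set set" where
  "four_cycles d = {{{w, x}, {x, y}, {y, z}, {z, w}} | w x y z.
     distinct [w, x, y, z] \<and> Q_adj d w x \<and> Q_adj d x y \<and> Q_adj d y z \<and> Q_adj d z w}"

definition parallel :: "nat \<Rightarrow> edge \<Rightarrow> edge \<Rightarrow> bool" where
  "parallel d e e' \<longleftrightarrow> e \<noteq> e' \<and> \<not> edges_adjacent e e' \<and> (\<exists>C \<in> four_cycles d. e \<in> C \<and> e' \<in> C)"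

definition partial_edge_coloring :: "nat \<Rightarrow> (edge \<rightharpoonup> nat) \<Rightarrow> bool" where
  "partial_edge_coloring d \<phi> \<longleftrightarrow> dom \<phi> \<subseteq> Q_edges d \<and> ran \<phi> \<subseteq> {1..d}"

definition proper_edge_coloring :: "nat \<Rightarrow> (edge \<Rightarrow> nat) \<Rightarrow> bool" where
  "proper_edge_coloring d f \<longleftrightarrow> f \<in> Q_edges d \<rightarrow> {1..d} \<and>
     (\<forall>e \<in> Q_edges d. \<forall>e' \<in> Q_edges d. edges_adjacent e e' \<longrightarrow> f e \<noteq> f e')"

definition avoidable :: "nat \<Rightarrow> (edge \<rightharpoonup> nat) \<Rightarrow> bool" where
  "avoidable d \<phi> \<longleftrightarrow> (\<exists>f. proper_edge_coloring d f \<and> (\<forall>e \<in> dom \<phi>. \<phi> e \<noteq> Some (f e)))"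

end

theory Submission
  imports Defs "HOL-Combinatorics.Permutations"
begin

text \<open>It is enough that every colour is used on at most \<open>d / 8\<close> edges. Colour each direction with
  its own colour \<open>p i\<close> for a random permutation \<open>p\<close>. The expected number of conflict edges is at
  most \<open>d / 8\<close>, and so is the expected number of pairs of a conflict edge \<open>e\<close> and a direction \<open>j\<close>
  for which the translate of \<open>e\<close> along \<open>j\<close> is precoloured \<open>p j\<close>. For such a good \<open>p\<close>, every
  conflict edge \<open>e\<close> can greedily be given a direction \<open>j\<close> such that the 4-cycles spanned by \<open>e\<close> and
  \<open>j\<close> are edge-disjoint and exchanging the two colours on each of them removes all conflicts and
  creates no new one.\<close>

section \<open>Vertices, flips and edge directions in the hypercube\<close>

definition flip :: "nat \<Rightarrow> vertex \<Rightarrow> vertex" where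
  "flip i v = v(i := 1 - v i)"

definition dir_edge :: "nat \<Rightarrow> vertex \<Rightarrow> edge" where
  "dir_edge i v = {v, flip i v}"

text \<open>The description is unique by \<open>dir_edge_eqD\<close>: an edge determines the
  coordinate in which its ends differ.\<close>

definition edge_dir :: "edge \<Rightarrow> nat" where
  "edge_dir e = (THE i. \<exists>v. e = dir_edge i v)"

lemma Q_verts_value: "v \<in> Q_verts d \<Longrightarrow> i \<in> {1..d} \<Longrightarrow> v i = 0 \<or> v i = 1"
  unfolding Q_verts_def using PiE_mem[of v "{1..d}" "\<lambda>_. {0, 1}" i] by blast

lemma flip_in_Q_verts:
  assumes "v \<in> Q_verts d" "i \<in> {1..d}"
  shows "flip i v \<in> Q_verts d"
  unfolding Q_verts_def
proof (rule PiE_I)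
  show "flip i v k \<in> {0, 1}" if "k \<in> {1..d}" for k
    using Q_verts_value[OF assms(1) that] by (cases "k = i") (auto simp: flip_def)
  show "flip i v k = undefined" if "k \<notin> {1..d}" for k
  proof -
    have "k \<noteq> i" using that assms(2) by blast
    then have "flip i v k = v k" by (simp add: flip_def)
    also have "\<dots> = undefined" using assms(1) that unfolding Q_verts_def by (rule PiE_arb)
    finally show ?thesis .
  qed
qed

lemma flip_flip: "v \<in> Q_verts d \<Longrightarrow> i \<in> {1..d} \<Longrightarrow> flip i (flip i v) = v"
  using Q_verts_value[of v d i] by (auto simp: flip_def)

lemma flip_commute: "flip i (flip j v) = flip j (flip i v)"
  by (auto simp: flip_def fun_upd_twist)

text \<open>Holds for every function \<open>v\<close>, since truncated \<open>1 - n\<close> differs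
  from \<open>n\<close> for every natural \<open>n\<close>. Only involutivity of \<open>flip\<close>
  requires 0/1 values.\<close>

lemma flip_apply_neq_iff: "flip i v k \<noteq> v k \<longleftrightarrow> k = i"
  by (cases "v i") (auto simp: flip_def)

lemma flip_eq_iff: "flip i v = flip j v \<longleftrightarrow> i = j"
  using flip_apply_neq_iff by metis

lemma dir_edge_eqD:
  assumes "dir_edge i v = dir_edge j w"
  shows "i = j \<and> (w = v \<or> w = flip i v)"
proof -
  have "(v = w \<and> flip i v = flip j w) \<or> (v = flip j w \<and> flip i v = w)"
    using assms unfolding dir_edge_def doubleton_eq_iff by blast
  then show ?thesis
    using flip_apply_neq_iff by metis
qed

lemma edge_dir_dir_edge [simp]: "edge_dir (dir_edge i v) = i"
  unfolding edge_dir_def by (rule the_equality) (auto dest: dir_edge_eqD)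

lemma dir_edge_flip:
  "v \<in> Q_verts d \<Longrightarrow> i \<in> {1..d} \<Longrightarrow> dir_edge i (flip i v) = dir_edge i v"
  by (auto simp: dir_edge_def flip_flip)

lemma image_flip_dir_edge: "flip j ` dir_edge i v = dir_edge i (flip j v)"
  by (simp add: dir_edge_def flip_commute)

text \<open>Outside \<open>{1..d}\<close> both vertices are \<open>undefined\<close> by
  extensionality, so the single differing coordinate determines the neighbour completely.\<close>

lemma Q_adj_iff:
  "Q_adj d u v \<longleftrightarrow> u \<in> Q_verts d \<and> (\<exists>i\<in>{1..d}. v = flip i u)"
proof
  assume adj: "Q_adj d u v"
  then have u: "u \<in> Q_verts d" and v: "v \<in> Q_verts d"
    and "card {i \<in> {1..d}. u i \<noteq> v i} = 1"
    by (auto simp: Q_adj_def)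
  then obtain i where i: "{k \<in> {1..d}. u k \<noteq> v k} = {i}"
    by (auto simp: card_1_singleton_iff)
  then have i_in: "i \<in> {1..d}" by blast
  have diff: "u k \<noteq> v k \<longleftrightarrow> k = i" if "k \<in> {1..d}" for k
    using i that by blast
  have "v k = flip i u k" for k
  proof (cases "k \<in> {1..d}")
    case True
    then show ?thesis
      using diff[OF True] Q_verts_value[OF u True] Q_verts_value[OF v True]
      by (cases "k = i") (auto simp: flip_def)
  next
    case False
    then show ?thesis
      using u v i_in by (auto simp: flip_def Q_verts_def PiE_iff extensional_def)
  qed
  then show "u \<in> Q_verts d \<and> (\<exists>i\<in>{1..d}. v = flip i u)"
    using u i_in by blast
next
  assume "u \<in> Q_verts d \<and> (\<exists>i\<in>{1..d}. v = flip i u)"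
  then obtain i where u: "u \<in> Q_verts d" and i: "i \<in> {1..d}" and v: "v = flip i u"
    by blast
  have "{k \<in> {1..d}. u k \<noteq> v k} = {i}"
    using i flip_apply_neq_iff[of i u] unfolding v by fastforce
  then show "Q_adj d u v"
    using u i v flip_in_Q_verts by (simp add: Q_adj_def)
qed

lemma Q_edges_eq: "Q_edges d = {dir_edge i v | i v. i \<in> {1..d} \<and> v \<in> Q_verts d}"
  unfolding Q_edges_def dir_edge_def Q_adj_iff by blast

lemma finite_Q_edges: "finite (Q_edges d)"
proof -
  have "Q_edges d = (\<lambda>(i, v). dir_edge i v) ` ({1..d} \<times> Q_verts d)"
    unfolding Q_edges_eq by force
  moreover have "finite (Q_verts d)"
    unfolding Q_verts_def by (intro finite_PiE) auto
  ultimately show ?thesis by simp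
qed

lemma Q_edges_edge_dir:
  assumes "e \<in> Q_edges d"
  obtains v where "v \<in> Q_verts d" "edge_dir e \<in> {1..d}" "e = dir_edge (edge_dir e) v"
  using assms unfolding Q_edges_eq by auto

text \<open>Either end of an edge may serve as its base point.\<close>

lemma edge_eq_dir_edge:
  assumes "e \<in> Q_edges d" "v \<in> e"
  shows "v \<in> Q_verts d" "e = dir_edge (edge_dir e) v"
proof -
  obtain w where w: "w \<in> Q_verts d" "edge_dir e \<in> {1..d}" "e = dir_edge (edge_dir e) w"
    using Q_edges_edge_dir[OF assms(1)] .
  have v: "v = w \<or> v = flip (edge_dir e) w"
    using assms(2) w(3) by (auto simp: dir_edge_def)
  show "v \<in> Q_verts d" using v w flip_in_Q_verts by auto
  show "e = dir_edge (edge_dir e) v" using v w dir_edge_flip by metis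
qed

section \<open>Colourings described by vertex and direction\<close>

text \<open>Here \<open>g v i\<close> is the colour of the edge at \<open>v\<close> in direction \<open>i\<close>.\<close>

lemma avoidableI:
  assumes dom: "dom \<phi> \<subseteq> Q_edges d"
    and range: "\<And>v i. v \<in> Q_verts d \<Longrightarrow> i \<in> {1..d} \<Longrightarrow> g v i \<in> {1..d}"
    and inv: "\<And>v i. v \<in> Q_verts d \<Longrightarrow> i \<in> {1..d} \<Longrightarrow> g (flip i v) i = g v i"
    and inj: "\<And>v. v \<in> Q_verts d \<Longrightarrow> inj_on (g v) {1..d}"
    and avoid: "\<And>v i. v \<in> Q_verts d \<Longrightarrow> i \<in> {1..d} \<Longrightarrow> \<phi> (dir_edge i v) \<noteq> Some (g v i)"
  shows "avoidable d \<phi>"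
proof -
  \<comment> \<open>Either end may be picked here: \<open>inv\<close> makes the value independent of
    the choice.\<close>
  define f where "f e = g (SOME v. v \<in> e) (edge_dir e)" for e
  have f: "f e = g v (edge_dir e)" if "e \<in> Q_edges d" "v \<in> e" for e v
  proof -
    define w where "w = (SOME v. v \<in> e)"
    have "w \<in> e" unfolding w_def using that(2) by (metis someI)
    then have w: "w \<in> Q_verts d" "e = dir_edge (edge_dir e) w"
      using edge_eq_dir_edge that(1) by blast+
    have "edge_dir e \<in> {1..d}" using Q_edges_edge_dir that(1) by metis
    moreover have "v = w \<or> v = flip (edge_dir e) w"
      using that(2) w(2) by (auto simp: dir_edge_def)
    ultimately show ?thesis
      using inv[OF w(1)] by (auto simp: f_def w_def[symmetric])
  qed
  have "f e \<in> {1..d} \<and> \<phi> e \<noteq> Some (f e)" if e: "e \<in> Q_edges d" for e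
  proof -
    obtain v where v: "v \<in> Q_verts d" "edge_dir e \<in> {1..d}" "e = dir_edge (edge_dir e) v"
      using Q_edges_edge_dir[OF e] .
    have "v \<in> e" by (subst v(3)) (simp add: dir_edge_def)
    then show ?thesis using f[OF e] range[OF v(1,2)] avoid[OF v(1,2)] v(3) by simp
  qed
  moreover have "f e \<noteq> f e'"
    if e: "e \<in> Q_edges d" "e' \<in> Q_edges d" and adj: "edges_adjacent e e'" for e e'
  proof
    assume eq: "f e = f e'"
    obtain v where v: "v \<in> e" "v \<in> e'" "e \<noteq> e'"
      using adj by (auto simp: edges_adjacent_def)
    have "g v (edge_dir e) = g v (edge_dir e')" using f e v eq by metis
    moreover have "edge_dir e \<in> {1..d}" "edge_dir e' \<in> {1..d}" "v \<in> Q_verts d"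
      using Q_edges_edge_dir e edge_eq_dir_edge v by metis+
    ultimately have "edge_dir e = edge_dir e'" using inj by (meson inj_onD)
    then show False using e v edge_eq_dir_edge by metis
  qed
  ultimately have "proper_edge_coloring d f"
    unfolding proper_edge_coloring_def by blast
  with \<open>\<And>e. e \<in> Q_edges d \<Longrightarrow> f e \<in> {1..d} \<and> \<phi> e \<noteq> Some (f e)\<close> dom show ?thesis
    unfolding avoidable_def by blast
qed

section \<open>The 4-cycles through a fixed edge\<close>

text \<open>The edges other than \<open>e\<close> of the 4-cycle spanned by \<open>e\<close> and the direction \<open>j\<close>.\<close>

definition cycle_rest :: "nat \<Rightarrow> edge \<Rightarrow> edge set" where
  "cycle_rest j e = insert (flip j ` e) (dir_edge j ` e)"

lemma image_flip_eqD:
  assumes "e \<in> Q_edges d" "j \<noteq> edge_dir e" "j' \<noteq> edge_dir e"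
    and "flip j ` e = flip j' ` e"
  shows "j = j'"
proof -
  obtain v where v: "e = dir_edge (edge_dir e) v"
    using Q_edges_edge_dir[OF assms(1)] .
  define i where "i = edge_dir e"
  have "dir_edge i (flip j v) = dir_edge i (flip j' v)"
    using assms(4) v image_flip_dir_edge i_def by metis
  then have "flip j' v = flip j v \<or> flip j' v = flip i (flip j v)"
    using dir_edge_eqD by blast
  then show ?thesis
  proof
    assume "flip j' v = flip j v"
    then show ?thesis by (simp add: flip_eq_iff)
  next
    assume eq: "flip j' v = flip i (flip j v)"
    \<comment> \<open>Coordinate \<open>i\<close> rules out that the two ends are exchanged: neither
      translation changes it, but \<open>flip i\<close> does.\<close>
    have "flip j' v i = v i" using assms(3) flip_apply_neq_iff i_def by metis
    moreover have "flip i (flip j v) i \<noteq> v i"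
      using assms(2) flip_apply_neq_iff i_def by metis
    ultimately show ?thesis using eq by simp
  qed
qed

lemma edge_dir_image_flip: "e \<in> Q_edges d \<Longrightarrow> edge_dir (flip j ` e) = edge_dir e"
  by (metis Q_edges_edge_dir edge_dir_dir_edge image_flip_dir_edge)

text \<open>The direction of \<open>e'\<close> decides its role: if it is that of \<open>e\<close>,
  then \<open>e'\<close> is the translate of \<open>e\<close>, which determines \<open>j\<close>;
  otherwise \<open>j\<close> is itself the direction of \<open>e'\<close>.\<close>

lemma cycle_rest_disjoint:
  assumes "e \<in> Q_edges d" "j \<noteq> edge_dir e" "j' \<noteq> edge_dir e"
    and "e' \<in> cycle_rest j e" "e' \<in> cycle_rest j' e"
  shows "j = j'"
  using assms(4,5) image_flip_eqD[OF assms(1-3)] edge_dir_image_flip[OF assms(1)] assms(2,3)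
  unfolding cycle_rest_def by (metis edge_dir_dir_edge imageE insertE)

section \<open>Permutations with one or two prescribed values\<close>

lemma transpose_comp_permutes:
  assumes "p permutes S" "i \<in> S"
  shows "transpose i (p i) \<circ> p permutes S - {i}"
proof (rule permutes_superset)
  have "p i \<in> S" using assms permutes_in_image by metis
  then show "transpose i (p i) \<circ> p permutes S"
    using assms by (intro permutes_compose permutes_swap_id)
qed auto

lemma inj_transpose_comp: "inj_on (\<lambda>p. transpose i c \<circ> p) A"
  by (rule inj_onI) (metis comp_assoc id_comp transpose_comp_involutory)

text \<open>Composing with the transposition of \<open>i\<close> and \<open>c\<close> makes
  \<open>i\<close> a fixed point and embeds these permutations into those of \<open>S - {i}\<close>.
  Only a bound is claimed, since \<open>c\<close> may lie outside \<open>S\<close>.\<close>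

lemma card_permutes_one:
  assumes "finite S" "i \<in> S"
  shows "card {p. p permutes S \<and> p i = c} \<le> fact (card S - 1)"
proof -
  have "(\<lambda>p. transpose i c \<circ> p) ` {p. p permutes S \<and> p i = c} \<subseteq> {p. p permutes S - {i}}"
    using transpose_comp_permutes[OF _ assms(2)] by auto
  then have "card {p. p permutes S \<and> p i = c} \<le> card {p. p permutes S - {i}}"
    using assms inj_transpose_comp by (intro card_inj_on_le) (auto simp: finite_permutations)
  also have "\<dots> = fact (card S - 1)"
    using assms by (simp add: card_permutations)
  finally show ?thesis .
qed

text \<open>The same embedding removes \<open>i\<close> and turns the prescribed value at
  \<open>j\<close> into \<open>transpose i c c'\<close>, which leaves an instance of the one-point
  bound.\<close>

lemma card_permutes_two:
  assumes "finite S" "i \<in> S" "j \<in> S" "i \<noteq> j"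
  shows "card {p. p permutes S \<and> p i = c \<and> p j = c'} \<le> fact (card S - 2)"
proof -
  let ?T = "{q. q permutes S - {i} \<and> q j = transpose i c c'}"
  have "(\<lambda>p. transpose i c \<circ> p) ` {p. p permutes S \<and> p i = c \<and> p j = c'} \<subseteq> ?T"
    using transpose_comp_permutes[OF _ assms(2)] by auto
  moreover have "finite ?T"
    by (rule finite_subset[OF _ finite_permutations[of "S - {i}"]]) (use assms in auto)
  ultimately have "card {p. p permutes S \<and> p i = c \<and> p j = c'} \<le> card ?T"
    using inj_transpose_comp by (intro card_inj_on_le)
  also have "\<dots> \<le> fact (card (S - {i}) - 1)"
    using assms by (intro card_permutes_one) auto
  also have "card (S - {i}) - 1 = card S - 2"
    using assms by simp
  finally show ?thesis .
qed

section \<open>Double counting and greedy choice\<close>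

lemma sum_card_swap:
  assumes "finite A" "finite B"
  shows "(\<Sum>a\<in>A. card {b \<in> B. R a b}) = (\<Sum>b\<in>B. card {a \<in> A. R a b})"
  unfolding card_eq_sum using assms by (rule sum.swap_restrict)

text \<open>\<open>X e g l\<close> is the set of choices for \<open>e\<close> ruled out once
  \<open>g\<close> has chosen \<open>l\<close>. Elements are served one at a time: each earlier one
  excludes at most \<open>m\<close> options, so one remains, and the symmetry of \<open>X\<close>
  keeps the earlier choices valid.\<close>

lemma greedy_choice:
  fixes X :: "'a \<Rightarrow> 'a \<Rightarrow> 'b \<Rightarrow> 'b set"
  assumes "finite K"
    and "\<And>e. e \<in> K \<Longrightarrow> finite (A e)"
    and "\<And>e g l. e \<in> K \<Longrightarrow> g \<in> K \<Longrightarrow> card (A e \<inter> X e g l) \<le> m"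
    and "\<And>e g j l. j \<in> X e g l \<Longrightarrow> l \<in> X g e j"
    and "\<And>e. e \<in> K \<Longrightarrow> m * card K < card (A e)"
  shows "\<exists>J. \<forall>e\<in>K. J e \<in> A e \<and> (\<forall>g\<in>K. g \<noteq> e \<longrightarrow> J e \<notin> X e g (J g))"
proof -
  have "\<exists>J. \<forall>e\<in>L. J e \<in> A e \<and> (\<forall>g\<in>L. g \<noteq> e \<longrightarrow> J e \<notin> X e g (J g))" if "L \<subseteq> K" for L
    using finite_subset[OF that assms(1)] that
  proof (induction L rule: finite_induct)
    case empty
    then show ?case by simp
  next
    case (insert e L)
    then obtain J where J: "\<forall>e\<in>L. J e \<in> A e \<and> (\<forall>g\<in>L. g \<noteq> e \<longrightarrow> J e \<notin> X e g (J g))"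
      by auto
    let ?U = "\<Union>g\<in>L. A e \<inter> X e g (J g)"
    have "card ?U \<le> (\<Sum>g\<in>L. card (A e \<inter> X e g (J g)))"
      using insert.hyps by (intro card_UN_le)
    also have "\<dots> \<le> (\<Sum>g\<in>L. m)"
      using insert.prems assms(3) by (intro sum_mono) auto
    also have "\<dots> \<le> m * card K"
      using insert.prems card_mono[OF assms(1), of L] by simp
    also have "\<dots> < card (A e)"
      using assms(5) insert.prems by simp
    finally have "\<not> A e \<subseteq> ?U"
      by (metis (no_types, lifting) card_mono finite_UN_I finite_Int assms(2)
          insert.hyps(1) insert.prems insert_subset leD)
    then obtain j where j: "j \<in> A e" "\<And>g. g \<in> L \<Longrightarrow> j \<notin> X e g (J g)"
      by blast
    have "\<forall>e'\<in>insert e L. (J(e := j)) e' \<in> A e' \<and>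
        (\<forall>g\<in>insert e L. g \<noteq> e' \<longrightarrow> (J(e := j)) e' \<notin> X e' g ((J(e := j)) g))"
    proof (intro ballI conjI impI)
      fix e' assume "e' \<in> insert e L"
      then show "(J(e := j)) e' \<in> A e'" using J j(1) by auto
    next
      fix e' g assume "e' \<in> insert e L" "g \<in> insert e L" "g \<noteq> e'"
      then consider "e' = e" "g \<in> L" "g \<noteq> e" | "g = e" "e' \<in> L" "e' \<noteq> e"
        | "g \<in> L" "e' \<in> L" "g \<noteq> e" "e' \<noteq> e"
        by blast
      then show "(J(e := j)) e' \<notin> X e' g ((J(e := j)) g)"
      proof cases
        case 1
        then show ?thesis using j(2) by simp
      next
        case 2
        then show ?thesis using j(2)[of e'] assms(4)[of "J e'" e' e j] by auto
      next
        case 3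
        then show ?thesis using J \<open>g \<noteq> e'\<close> by simp
      qed
    qed
    then show ?case by blast
  qed
  then show ?thesis by blast
qed

section \<open>Averaging over permutations of the colours\<close>

definition conflicts :: "(edge \<rightharpoonup> nat) \<Rightarrow> (nat \<Rightarrow> nat) \<Rightarrow> edge set" where
  "conflicts \<phi> p = {e. \<phi> e = Some (p (edge_dir e))}"

text \<open>Exchanging the colours on the 4-cycle spanned by \<open>e\<close> and \<open>j\<close>
  gives the translate of \<open>e\<close> the colour \<open>p j\<close>; for these \<open>j\<close>
  that creates a new conflict.\<close>

definition blocked_dirs :: "nat \<Rightarrow> (edge \<rightharpoonup> nat) \<Rightarrow> (nat \<Rightarrow> nat) \<Rightarrow> edge \<Rightarrow> nat set" where
  "blocked_dirs d \<phi> p e = {j \<in> {1..d} - {edge_dir e}. \<phi> (flip j ` e) = Some (p j)}"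

text \<open>The bound holds on average over all permutations.\<close>

lemma exists_permutation_few_conflicts:
  assumes dom: "dom \<phi> \<subseteq> Q_edges d" and "d \<ge> 1" and few: "8 * card (dom \<phi>) \<le> d * d"
  shows "\<exists>p. p permutes {1..d} \<and>
    2 * (3 * card (conflicts \<phi> p) + (\<Sum>e\<in>conflicts \<phi> p. card (blocked_dirs d \<phi> p e))) \<le> d"
proof (rule ccontr)
  assume contra: "\<not> ?thesis"
  let ?S = "{p. p permutes {1..d}}"
  let ?N = "dom \<phi>"
  \<comment> \<open>The index set \<open>?E\<close> does not depend on \<open>p\<close>, which
    allows the blocked pairs \<open>?B p\<close> to be counted by swapping the two sums.\<close>
  let ?E = "Sigma ?N (\<lambda>e. {1..d} - {edge_dir e})"
  let ?B = "\<lambda>p. {x \<in> ?E. \<phi> (fst x) = Some (p (edge_dir (fst x))) \<and>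
                        \<phi> (flip (snd x) ` fst x) = Some (p (snd x))}"
  have finN: "finite ?N" using dom finite_Q_edges finite_subset by blast
  then have finE: "finite ?E" by auto
  have finS: "finite ?S" by (simp add: finite_permutations)
  have cardS: "card ?S = fact d" by (simp add: card_permutations)
  have dir: "edge_dir e \<in> {1..d}" if "e \<in> ?N" for e
    using that dom Q_edges_edge_dir by blast
  have K: "conflicts \<phi> p = {e \<in> ?N. \<phi> e = Some (p (edge_dir e))}" for p
    by (auto simp: conflicts_def)
  have B: "(\<Sum>e\<in>conflicts \<phi> p. card (blocked_dirs d \<phi> p e)) = card (?B p)" for p
  proof -
    have "?B p = Sigma (conflicts \<phi> p) (blocked_dirs d \<phi> p)"
      unfolding K blocked_dirs_def by auto
    then show ?thesis
      using finN by (simp add: K blocked_dirs_def)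
  qed
  have "(\<Sum>p\<in>?S. card (conflicts \<phi> p)) = (\<Sum>e\<in>?N. card {p \<in> ?S. \<phi> e = Some (p (edge_dir e))})"
    unfolding K by (rule sum_card_swap[OF finS finN])
  also have "\<dots> \<le> (\<Sum>e\<in>?N. fact (d - 1))"
  proof (rule sum_mono)
    fix e assume e: "e \<in> ?N"
    then obtain c where "\<phi> e = Some c" by blast
    then have "{p \<in> ?S. \<phi> e = Some (p (edge_dir e))} = {p. p permutes {1..d} \<and> p (edge_dir e) = c}"
      by auto
    then show "card {p \<in> ?S. \<phi> e = Some (p (edge_dir e))} \<le> fact (d - 1)"
      using card_permutes_one[OF _ dir[OF e], of c] by simp
  qed
  finally have sumK: "(\<Sum>p\<in>?S. card (conflicts \<phi> p)) \<le> card ?N * fact (d - 1)"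
    by simp
  have "(\<Sum>p\<in>?S. card (?B p)) = (\<Sum>x\<in>?E. card {p \<in> ?S. \<phi> (fst x) = Some (p (edge_dir (fst x))) \<and>
                        \<phi> (flip (snd x) ` fst x) = Some (p (snd x))})"
    by (rule sum_card_swap[OF finS finE])
  also have "\<dots> \<le> (\<Sum>x\<in>?E. fact (d - 2))"
  proof (rule sum_mono)
    fix x assume x: "x \<in> ?E"
    then obtain e j where ej: "x = (e, j)" "e \<in> ?N" "j \<in> {1..d}" "edge_dir e \<noteq> j"
      by blast
    have "{p \<in> ?S. \<phi> e = Some (p (edge_dir e)) \<and> \<phi> (flip j ` e) = Some (p j)}
        \<subseteq> {p. p permutes {1..d} \<and> p (edge_dir e) = the (\<phi> e) \<and> p j = the (\<phi> (flip j ` e))}"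
      by auto
    then have "card {p \<in> ?S. \<phi> e = Some (p (edge_dir e)) \<and> \<phi> (flip j ` e) = Some (p j)}
        \<le> card {p. p permutes {1..d} \<and> p (edge_dir e) = the (\<phi> e) \<and> p j = the (\<phi> (flip j ` e))}"
      by (intro card_mono finite_subset[OF _ finS]) auto
    also have "\<dots> \<le> fact (d - 2)"
      using card_permutes_two[OF _ dir[OF ej(2)] ej(3,4)] by simp
    finally show "card {p \<in> ?S. \<phi> (fst x) = Some (p (edge_dir (fst x))) \<and>
                        \<phi> (flip (snd x) ` fst x) = Some (p (snd x))} \<le> fact (d - 2)"
      using ej(1) by simp
  qed
  \<comment> \<open>Each precoloured edge has \<open>d - 1\<close> directions besides its own; for
    \<open>d = 1\<close> there are none.\<close>
  also have "\<dots> = card ?N * ((d - 1) * fact (d - 2))"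
    using finN dir by simp
  also have "\<dots> \<le> card ?N * fact (d - 1)"
  proof (cases "d = 1")
    case False
    then have "(d - 1) * fact (d - 2) = (fact (d - 1) :: nat)"
      using \<open>d \<ge> 1\<close> fact_reduce[of "d - 1", where 'a = nat] by (simp add: numeral_2_eq_2)
    then show ?thesis by simp
  qed simp
  finally have sumB: "(\<Sum>p\<in>?S. card (?B p)) \<le> card ?N * fact (d - 1)" .
  \<comment> \<open>If every permutation failed, each would contribute at least
    \<open>d + 1\<close>, whereas the two counts bound the total by
    \<open>fact d * d\<close>.\<close>
  have "fact d * (d + 1) = (\<Sum>p\<in>?S. d + 1)"
    using cardS by simp
  also have "\<dots> \<le> (\<Sum>p\<in>?S. 2 * (3 * card (conflicts \<phi> p) + card (?B p)))"
  proof (rule sum_mono)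
    fix p assume "p \<in> ?S"
    then have "\<not> 2 * (3 * card (conflicts \<phi> p) + card (?B p)) \<le> d"
      using contra B by auto
    then show "d + 1 \<le> 2 * (3 * card (conflicts \<phi> p) + card (?B p))" by linarith
  qed
  also have "\<dots> = 6 * (\<Sum>p\<in>?S. card (conflicts \<phi> p)) + 2 * (\<Sum>p\<in>?S. card (?B p))"
    by (simp add: sum.distrib sum_distrib_left)
  \<comment> \<open>The weights 6 and 2 add up to the 8 in \<open>few\<close>.\<close>
  also have "\<dots> \<le> 8 * card ?N * fact (d - 1)"
    using sumK sumB by linarith
  also have "\<dots> \<le> d * d * fact (d - 1)"
    using few by (intro mult_right_mono) auto
  also have "\<dots> = fact d * d"
    using \<open>d \<ge> 1\<close> by (simp add: fact_reduce)
  finally show False by simp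
qed

section \<open>Switching colours on edge-disjoint 4-cycles\<close>

text \<open>The colours \<open>p (edge_dir e)\<close> and \<open>p (J e)\<close> are exchanged on
  the 4-cycle of each conflict edge \<open>e\<close>. The third condition on \<open>J\<close>
  protects the translate of \<open>e\<close>, the fourth the two edges in direction
  \<open>J e\<close>; the second and fourth together with the injectivity conditions make the cycles
  edge-disjoint.\<close>

lemma avoidable_if_switches:
  assumes dom: "dom \<phi> \<subseteq> Q_edges d" and p: "p permutes {1..d}"
    and J: "\<And>e. e \<in> conflicts \<phi> p \<Longrightarrow> J e \<in> {1..d}"
      "\<And>e. e \<in> conflicts \<phi> p \<Longrightarrow> J e \<notin> edge_dir ` conflicts \<phi> p"
      "\<And>e. e \<in> conflicts \<phi> p \<Longrightarrow> \<phi> (flip (J e) ` e) \<noteq> Some (p (J e))"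
      "\<And>e e'. e \<in> conflicts \<phi> p \<Longrightarrow> e' \<in> cycle_rest (J e) e \<Longrightarrow> \<phi> e' \<noteq> \<phi> e"
    and inj: "inj_on J (conflicts \<phi> p)" "inj_on (\<lambda>e. flip (J e) ` e) (conflicts \<phi> p)"
  shows "avoidable d \<phi>"
proof -
  let ?K = "conflicts \<phi> p"
  \<comment> \<open>\<open>R v k l\<close>: some switched 4-cycle passes through \<open>v\<close> in the directions \<open>k\<close> and \<open>l\<close>.
    Edge-disjointness makes this symmetric relation functional, so \<open>s v\<close> is an involution.\<close>
  define R where "R v k l \<longleftrightarrow> (\<exists>e\<in>?K. v \<in> e \<union> flip (J e) ` e \<and>
      (k = edge_dir e \<and> l = J e \<or> k = J e \<and> l = edge_dir e))" for v k l
  define s where "s v k = (if \<exists>l. R v k l then THE l. R v k l else k)" for v k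
  have KE: "e \<in> Q_edges d" if "e \<in> ?K" for e
    using that dom by (auto simp: conflicts_def)
  have dirK: "edge_dir e \<in> {1..d}" if "e \<in> ?K" for e
    using Q_edges_edge_dir[OF KE[OF that]] by blast
  \<comment> \<open>A conflict edge parallel to \<open>e\<close> in the same direction would have
    the precolour of \<open>e\<close>, which \<open>J(4)\<close> forbids on the cycle.\<close>
  have flip_notin: "flip (J e) ` e \<notin> ?K" if e: "e \<in> ?K" for e
  proof
    assume "flip (J e) ` e \<in> ?K"
    then have "\<phi> (flip (J e) ` e) = \<phi> e"
      using e edge_dir_image_flip[OF KE[OF e]] by (simp add: conflicts_def)
    then show False using J(4)[OF e] by (simp add: cycle_rest_def)
  qed
  have cyc: "dir_edge (edge_dir e) v = e \<and> v \<in> e \<or>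
      dir_edge (edge_dir e) v = flip (J e) ` e \<and> v \<in> flip (J e) ` e"
    if e: "e \<in> ?K" and v: "v \<in> e \<union> flip (J e) ` e" for e v
    using v
  proof
    assume "v \<in> e"
    then show ?thesis using edge_eq_dir_edge[OF KE[OF e]] by simp
  next
    assume v: "v \<in> flip (J e) ` e"
    then obtain u where u: "u \<in> e" "v = flip (J e) u" by blast
    have "e = dir_edge (edge_dir e) u" using edge_eq_dir_edge[OF KE[OF e] u(1)] by simp
    then have "flip (J e) ` e = dir_edge (edge_dir e) v"
      using image_flip_dir_edge u(2) by metis
    then show ?thesis using v by simp
  qed
  have R_sym: "R v k l \<longleftrightarrow> R v l k" for v k l
    unfolding R_def by blast
  have R_unique: "l = l'" if R: "R v k l" "R v k l'" for v k l l'
  proof -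
    obtain e where e: "e \<in> ?K" "v \<in> e \<union> flip (J e) ` e"
      "k = edge_dir e \<and> l = J e \<or> k = J e \<and> l = edge_dir e"
      using R(1) unfolding R_def by blast
    obtain g where g: "g \<in> ?K" "v \<in> g \<union> flip (J g) ` g"
      "k = edge_dir g \<and> l' = J g \<or> k = J g \<and> l' = edge_dir g"
      using R(2) unfolding R_def by blast
    \<comment> \<open>Through \<open>v\<close> passes only one edge in the common direction. It is
      the conflict edge of both cycles or the translate in both; the mixed case is excluded by
      \<open>flip_notin\<close>.\<close>
    have "e = g" if "edge_dir e = edge_dir g"
      using cyc[OF e(1,2)] cyc[OF g(1,2)] flip_notin e(1) g(1) inj(2) that
      unfolding inj_on_def by metis
    moreover have "e = g" if "J e = J g"
      using inj(1) that e(1) g(1) by (meson inj_onD)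
    moreover have "J e \<noteq> edge_dir g" "J g \<noteq> edge_dir e"
      using J(2) e(1) g(1) by blast+
    ultimately show ?thesis using e(3) g(3) by metis
  qed
  have s_R: "s v k = l" if "R v k l" for v k l
    using that R_unique unfolding s_def by (metis the_equality)
  have s_id: "s v k = k" if "\<nexists>l. R v k l" for v k
    using that by (simp add: s_def)
  have s_s: "s v (s v k) = k" for v k
    using s_R s_id R_sym by metis
  have s_in: "s v k \<in> {1..d}" if "k \<in> {1..d}" for v k
  proof (cases "\<exists>l. R v k l")
    case True
    then obtain l where l: "R v k l" by blast
    then have "l \<in> {1..d}" unfolding R_def using J(1) dirK by blast
    then show ?thesis using s_R[OF l] by simp
  qed (use that s_id in simp)
  \<comment> \<open>A switched cycle is closed under its two flips, so both ends of an edge see the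
    same switch.\<close>
  have V: "flip k v \<in> e \<union> flip (J e) ` e"
    if e: "e \<in> ?K" and v: "v \<in> e \<union> flip (J e) ` e" and k: "k = edge_dir e \<or> k = J e" for e v k
    using k
  proof
    assume "k = edge_dir e"
    then have "flip k v \<in> dir_edge (edge_dir e) v" by (simp add: dir_edge_def)
    then show ?thesis using cyc[OF e v] by auto
  next
    assume k: "k = J e"
    show ?thesis
    proof (cases "v \<in> e")
      case True
      then show ?thesis using k by blast
    next
      case False
      then obtain u where u: "u \<in> e" "v = flip (J e) u" using v by blast
      then have "flip k v = u"
        using flip_flip[OF edge_eq_dir_edge(1)[OF KE[OF e] u(1)] J(1)[OF e]] k by simp
      then show ?thesis using u(1) by blast
    qed
  qed
  have R_flip: "R (flip k v) k l" if R: "R v k l" for v k l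
  proof -
    obtain e where e: "e \<in> ?K" "v \<in> e \<union> flip (J e) ` e"
      and kl: "k = edge_dir e \<and> l = J e \<or> k = J e \<and> l = edge_dir e"
      using R unfolding R_def by blast
    then have "flip k v \<in> e \<union> flip (J e) ` e" by (intro V[OF e]) auto
    with e(1) kl show ?thesis unfolding R_def by (intro bexI[of _ e] conjI)
  qed
  show ?thesis
  proof (rule avoidableI[OF dom, where g = "\<lambda>v k. p (s v k)"])
    fix v k assume v: "v \<in> Q_verts d" and k: "k \<in> {1..d}"
    show "p (s v k) \<in> {1..d}" using s_in[OF k] p permutes_in_image by metis
    have "R (flip k v) k l \<longleftrightarrow> R v k l" for l
      using R_flip flip_flip[OF v k] by metis
    then have "R (flip k v) k = R v k" by blast
    then show "p (s (flip k v) k) = p (s v k)" by (simp add: s_def)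
    show "\<phi> (dir_edge k v) \<noteq> Some (p (s v k))"
    proof (cases "\<exists>l. R v k l")
      case True
      then obtain l where l: "R v k l" by blast
      then obtain e where e: "e \<in> ?K" "v \<in> e \<union> flip (J e) ` e"
        "k = edge_dir e \<and> l = J e \<or> k = J e \<and> l = edge_dir e"
        unfolding R_def by blast
      have \<phi>e: "\<phi> e = Some (p (edge_dir e))" using e(1) by (simp add: conflicts_def)
      from e(3) show ?thesis
      proof
        \<comment> \<open>The edge is \<open>e\<close> or its translate, now coloured
          \<open>p (J e)\<close>: injectivity of \<open>p\<close> settles the first,
          \<open>J(3)\<close> the second.\<close>
        assume kl: "k = edge_dir e \<and> l = J e"
        have "p (J e) \<noteq> p (edge_dir e)"
          using permutes_inj[OF p] J(2)[OF e(1)] e(1) by (metis imageI injD)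
        then show ?thesis
          using cyc[OF e(1,2)] J(3)[OF e(1)] \<phi>e s_R[OF l] kl by auto
      next
        \<comment> \<open>The edge now receives the precolour of \<open>e\<close>, which no other
          edge of the cycle has by \<open>J(4)\<close>.\<close>
        assume kl: "k = J e \<and> l = edge_dir e"
        obtain u where u: "u \<in> e" "v = u \<or> v = flip k u"
          using e(2) kl by blast
        have "dir_edge k v = dir_edge k u"
          using u dir_edge_flip edge_eq_dir_edge(1)[OF KE[OF e(1)]] k by metis
        then have "dir_edge k v \<in> cycle_rest (J e) e"
          using u(1) kl by (simp add: cycle_rest_def)
        then show ?thesis using J(4)[OF e(1)] \<phi>e s_R[OF l] kl by metis
      qed
    next
      \<comment> \<open>An edge on no switched cycle keeps its colour and is not a conflict edge,
        since every conflict edge lies on its own cycle.\<close>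
      case False
      show ?thesis
      proof
        assume "\<phi> (dir_edge k v) = Some (p (s v k))"
        then have "dir_edge k v \<in> ?K" using s_id[OF False] by (simp add: conflicts_def)
        moreover have "v \<in> dir_edge k v" by (simp add: dir_edge_def)
        ultimately have "R v k (J (dir_edge k v))"
          unfolding R_def by (intro bexI[of _ "dir_edge k v"]) auto
        then show False using False by blast
      qed
    qed
  next
    fix v
    show "inj_on (\<lambda>k. p (s v k)) {1..d}"
      by (rule inj_onI) (metis permutes_inj[OF p] injD s_s)
  qed
qed

section \<open>Choice of the switching directions\<close>

lemma avoidable_if_colors_rare:
  assumes "d \<ge> 1" and \<phi>: "partial_edge_coloring d \<phi>"
    and rare: "\<And>c. c \<in> {1..d} \<Longrightarrow> 8 * card {e. \<phi> e = Some c} \<le> d"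
  shows "avoidable d \<phi>"
proof -
  have dom: "dom \<phi> \<subseteq> Q_edges d" and ran: "ran \<phi> \<subseteq> {1..d}"
    using \<phi> by (auto simp: partial_edge_coloring_def)
  have fin: "finite (dom \<phi>)" using dom finite_Q_edges finite_subset by blast
  have dom_eq: "dom \<phi> = (\<Union>c\<in>{1..d}. {e. \<phi> e = Some c})"
    using ran by (auto intro: ranI)
  have "card (dom \<phi>) \<le> (\<Sum>c\<in>{1..d}. card {e. \<phi> e = Some c})"
    unfolding dom_eq by (rule card_UN_le) simp
  then have "8 * card (dom \<phi>) \<le> (\<Sum>c\<in>{1..d}. 8 * card {e. \<phi> e = Some c})"
    by (simp add: sum_distrib_left[symmetric])
  also have "\<dots> \<le> (\<Sum>c\<in>{1..d}. d)"
    using rare by (rule sum_mono)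
  finally have "8 * card (dom \<phi>) \<le> d * d" by simp
  then obtain p where p: "p permutes {1..d}"
    and few: "2 * (3 * card (conflicts \<phi> p) +
        (\<Sum>e\<in>conflicts \<phi> p. card (blocked_dirs d \<phi> p e))) \<le> d"
    using exists_permutation_few_conflicts[OF dom \<open>d \<ge> 1\<close>] by blast
  let ?K = "conflicts \<phi> p"
  \<comment> \<open>Directions whose 4-cycle contains another edge with the precolour of
    \<open>e\<close>. Each such edge excludes at most one direction, by
    \<open>cycle_rest_disjoint\<close>.\<close>
  define F where "F e = (\<Union>e'\<in>{e'. \<phi> e' = \<phi> e}. {j \<in> {1..d} - {edge_dir e}. e' \<in> cycle_rest j e})"
    for e
  define A where "A e = {1..d} - (edge_dir ` ?K \<union> blocked_dirs d \<phi> p e \<union> F e)" for e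
  define X where "X e g l = {j. j = l \<or> flip j ` e = flip l ` g}" for e g :: edge and l :: nat
  have KN: "?K \<subseteq> dom \<phi>" by (auto simp: conflicts_def)
  then have finK: "finite ?K" using fin finite_subset by blast
  have KE: "e \<in> Q_edges d" if "e \<in> ?K" for e using that KN dom by blast
  have cardF: "8 * card (F e) \<le> d" if e: "e \<in> ?K" for e
  proof -
    obtain c where c: "\<phi> e = Some c" using e by (simp add: conflicts_def)
    then have c_in: "c \<in> {1..d}" using ran ranI[of \<phi> e c] by blast
    have fc: "finite {e'. \<phi> e' = Some c}" by (rule finite_subset[OF _ fin]) auto
    have "card (F e) \<le> (\<Sum>e'\<in>{e'. \<phi> e' = Some c}.
        card {j \<in> {1..d} - {edge_dir e}. e' \<in> cycle_rest j e})"
      unfolding F_def c using fc by (rule card_UN_le)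
    also have "\<dots> \<le> (\<Sum>e'\<in>{e'. \<phi> e' = Some c}. 1)"
    proof (rule sum_mono)
      fix e'
      show "card {j \<in> {1..d} - {edge_dir e}. e' \<in> cycle_rest j e} \<le> 1"
        using cycle_rest_disjoint[OF KE[OF e]] by (auto simp: card_le_Suc0_iff_eq)
    qed
    finally show ?thesis using rare[OF c_in] by simp
  qed
  have cardA: "2 * card ?K < card (A e)" if e: "e \<in> ?K" for e
  proof -
    let ?U = "edge_dir ` ?K \<union> blocked_dirs d \<phi> p e \<union> F e"
    have "card ?U \<le> card (edge_dir ` ?K) + card (blocked_dirs d \<phi> p e) + card (F e)"
      by (meson add_right_mono card_Un_le order_trans)
    moreover have "card (edge_dir ` ?K) \<le> card ?K" using finK by (rule card_image_le)
    moreover have "card (blocked_dirs d \<phi> p e) \<le> (\<Sum>e\<in>?K. card (blocked_dirs d \<phi> p e))"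
      using e finK by (intro member_le_sum) auto
    moreover have "finite ?U"
    proof -
      have "F e \<subseteq> {1..d}" "blocked_dirs d \<phi> p e \<subseteq> {1..d}"
        by (auto simp: F_def blocked_dirs_def)
      then show ?thesis using finK by (meson finite_Un finite_atLeastAtMost finite_imageI finite_subset)
    qed
    then have "d \<le> card (A e) + card ?U"
      using diff_card_le_card_Diff[of ?U "{1..d}"] by (simp add: A_def)
    \<comment> \<open>With \<open>k\<close> conflicts and \<open>B\<close> blocked pairs in total,
      at most \<open>k + B + d/8\<close> directions are forbidden. By \<open>few\<close>,
      \<open>3*k + B\<close> is at most \<open>d/2\<close>, so \<open>2*k + (k + B + d/8)\<close> is
      at most \<open>5*d/8\<close>, which is less than \<open>d\<close>.\<close>
    ultimately show ?thesis using few cardF[OF e] \<open>d \<ge> 1\<close> by (simp only: distrib_left)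
  qed
  have AD: "j \<noteq> edge_dir e" if "e \<in> ?K" "j \<in> A e" for e j
    using that by (auto simp: A_def)
  have "\<exists>J. \<forall>e\<in>?K. J e \<in> A e \<and> (\<forall>g\<in>?K. g \<noteq> e \<longrightarrow> J e \<notin> X e g (J g))"
  proof (rule greedy_choice[OF finK _ _ _ cardA])
    show "finite (A e)" for e by (simp add: A_def)
    show "l \<in> X g e j" if "j \<in> X e g l" for e g j l using that by (auto simp: X_def)
    \<comment> \<open>At most two options are excluded: \<open>l\<close> itself and, by
      \<open>image_flip_eqD\<close>, at most one direction carrying \<open>e\<close> to the
      translate used by \<open>g\<close>.\<close>
    fix e g l assume e: "e \<in> ?K"
    let ?M = "{j \<in> A e. flip j ` e = flip l ` g}"
    have fin: "finite ?M" by (simp add: A_def)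
    have "\<forall>j\<in>?M. \<forall>j'\<in>?M. j = j'"
    proof (intro ballI)
      fix j j' assume "j \<in> ?M" "j' \<in> ?M"
      then show "j = j'" using image_flip_eqD[OF KE[OF e] AD[OF e] AD[OF e], of j j'] by simp
    qed
    then have "card ?M \<le> 1"
      unfolding One_nat_def by (rule card_le_Suc0_iff_eq[OF fin, THEN iffD2])
    moreover have "A e \<inter> X e g l \<subseteq> insert l ?M"
      by (auto simp: X_def)
    then have "card (A e \<inter> X e g l) \<le> card (insert l ?M)"
      by (rule card_mono[rotated]) (simp add: A_def)
    ultimately show "card (A e \<inter> X e g l) \<le> 2"
      using card_insert_le_m1[of 2 "?M" l] by simp
  qed
  then obtain J where J: "\<And>e. e \<in> ?K \<Longrightarrow> J e \<in> A e"
    and JX: "\<And>e g. e \<in> ?K \<Longrightarrow> g \<in> ?K \<Longrightarrow> g \<noteq> e \<Longrightarrow> J e \<notin> X e g (J g)"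
    by blast
  show ?thesis
  proof (rule avoidable_if_switches[OF dom p])
    fix e assume e: "e \<in> ?K"
    show "J e \<in> {1..d}" "J e \<notin> edge_dir ` ?K" using J[OF e] by (auto simp: A_def)
    then show "\<phi> (flip (J e) ` e) \<noteq> Some (p (J e))"
      using J[OF e] e by (auto simp: A_def blocked_dirs_def)
    show "\<phi> e' \<noteq> \<phi> e" if "e' \<in> cycle_rest (J e) e" for e'
    proof
      assume "\<phi> e' = \<phi> e"
      moreover have "J e \<in> {j \<in> {1..d} - {edge_dir e}. e' \<in> cycle_rest j e}"
        using \<open>J e \<in> {1..d}\<close> AD[OF e J[OF e]] that by simp
      ultimately have "J e \<in> F e" unfolding F_def by (intro UN_I[of e']) simp_all
      then show False using J[OF e] by (simp add: A_def)
    qed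
  next
    have "J e \<noteq> J g \<and> flip (J e) ` e \<noteq> flip (J g) ` g" if "e \<in> ?K" "g \<in> ?K" "g \<noteq> e" for e g
      using JX[OF that] by (simp add: X_def)
    then show "inj_on J ?K" "inj_on (\<lambda>e. flip (J e) ` e) ?K"
      unfolding inj_on_def by metis+
  qed
qed

theorem theorem3p6:
  fixes d :: nat and \<phi> :: "edge \<rightharpoonup> nat" and a b :: "nat \<Rightarrow> real"
  assumes "d \<ge> 1"
    and "partial_edge_coloring d \<phi>"
    and "109 / 1776 * (real d)\<^sup>2 - 2 * b d * (a d - 7 * real d / 8) \<ge> 0"
    and "a d \<ge> b d"
  shows "((\<forall>c \<in> {1..d}. real (card {e. \<phi> e = Some c}) \<le> real d / 8) \<and>
          (\<forall>e \<in> Q_edges d. real (card {e' \<in> dom \<phi> - {e}. parallel d e e'}) \<le> b d) \<and>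
          (\<forall>i \<in> {1..d}. real (card (dom \<phi> \<inter> dim_matching d i)) \<le> a d)
            \<longrightarrow> avoidable d \<phi>)
       \<and> (\<forall>C1 C2 :: real. C1 \<ge> 1 \<longrightarrow> C2 = 2 * C1 * (C1 + 2) * 34\<^sup>2 \<longrightarrow>
            (\<forall>i \<in> {1..d}. real (card (dom \<phi> \<inter> dim_matching d i)) \<le> C1 * real d) \<longrightarrow>
            (\<forall>c \<in> {1..d}. real (card {e. \<phi> e = Some c}) \<le> real d / C2)
            \<longrightarrow> avoidable d \<phi>)"
proof -
  have rare: "avoidable d \<phi>"
    if "\<forall>c \<in> {1..d}. real (card {e. \<phi> e = Some c}) \<le> real d / 8"
  proof (rule avoidable_if_colors_rare[OF assms(1,2)])
    fix c assume "c \<in> {1..d}"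
    then have "real (8 * card {e. \<phi> e = Some c}) \<le> real d" using that by fastforce
    then show "8 * card {e. \<phi> e = Some c} \<le> d" by (simp only: of_nat_le_iff)
  qed
  \<comment> \<open>Since \<open>C1 * (C1 + 2)\<close> is at least 3 and
    \<open>2 * 34\<^sup>2\<close> is 2312, \<open>C2\<close> exceeds 8, so the colour bound of the
    second part implies that of the first.\<close>
  moreover have "real d / C2 \<le> real d / 8"
    if "C1 \<ge> 1" "C2 = 2 * C1 * (C1 + 2) * 34\<^sup>2" for C1 C2 :: real
  proof -
    have "1 * 3 \<le> C1 * (C1 + 2)" using that(1) by (intro mult_mono) auto
    moreover have "C2 = 2312 * (C1 * (C1 + 2))" unfolding that(2) by simp
    ultimately have "8 \<le> C2" by linarith
    then show ?thesis by (intro divide_left_mono) auto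
  qed
  ultimately show ?thesis by (meson order_trans)
qed

end
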